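(* For every acute triangle $ABC$ in which $BC$ is strictly the shortest side ($a<b$ and $a<c$), the distances from vertex $A$ satisfy $$AX_3<AX_9<AX_{10}<AX_2<AX_1<AX_6<AX_4<AX_{19}<AX_{16}.$$ Equivalently, in the vertex order, $X_3\prec X_9\prec X_{10}\prec X_2\prec X_1\prec X_6\prec X_4\prec X_{19}\prec X_{16}$.
   Context: $X_n$ denotes the $n$-th triangle center listed in Kimberling's Encyclopedia of Triangle Centers (ETC), given by barycentric coordinates in terms of $a=BC$, $b=CA$, $c=AB$. The vertex order is defined by: $P\prec Q$ if $P$ is closer to $A$ than $Q$ in every acute triangle $ABC$ with shortest side $BC$ (i.e. $a<b$, $a<c$). *)

theory Defs
  imports "HOL-Analysis.Analysis"
begin

definition bary :: "real^2 \<Rightarrow> real^2 \<Rightarrow> real^2 \<Rightarrow> real \<Rightarrow> real \<Rightarrow> real \<Rightarrow> real^2" where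
  "bary A B C u v w = (1 / (u + v + w)) *\<^sub>R (u *\<^sub>R A + v *\<^sub>R B + w *\<^sub>R C)"

text \<open>Conway's S = twice the area, from the side lengths (Heron).\<close>
definition conway_S :: "real \<Rightarrow> real \<Rightarrow> real \<Rightarrow> real" where
  "conway_S a b c = sqrt ((a+b+c) * (-a+b+c) * (a-b+c) * (a+b-c)) / 2"

text \<open>First barycentric coordinate f(a,b,c) of ETC centre X_n (for the centres used);
  the full coordinates are f(a,b,c) : f(b,c,a) : f(c,a,b).\<close>
definition etc_coord :: "nat \<Rightarrow> real \<Rightarrow> real \<Rightarrow> real \<Rightarrow> real" where
  "etc_coord n a b c =
    (if n = 1 then a
     else if n = 2 then 1
     else if n = 3 then a^2 * (b^2 + c^2 - a^2)
     else if n = 4 then 1 / (b^2 + c^2 - a^2)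
     else if n = 6 then a^2
     else if n = 9 then a * (b + c - a)
     else if n = 10 then b + c
     else if n = 16 then a^2 * (sqrt 3 * ((b^2 + c^2 - a^2) / 2) - conway_S a b c)
     else if n = 19 then a / (b^2 + c^2 - a^2)
     else undefined)"

definition etc_center :: "nat \<Rightarrow> real^2 \<Rightarrow> real^2 \<Rightarrow> real^2 \<Rightarrow> real^2" where
  "etc_center n A B C =
    (let a = dist B C; b = dist C A; c = dist A B in
     bary A B C (etc_coord n a b c) (etc_coord n b c a) (etc_coord n c a b))"

text \<open>Acute triangle: nondegenerate and every angle < pi/2, i.e. (law of cosines)
  the square of each side is less than the sum of the squares of the other two.\<close>
definition acute_triangle :: "real^2 \<Rightarrow> real^2 \<Rightarrow> real^2 \<Rightarrow> bool" where
  "acute_triangle A B C \<longleftrightarrow> \<not> collinear {A, B, C} \<and>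
     (dist B C)^2 < (dist C A)^2 + (dist A B)^2 \<and>
     (dist C A)^2 < (dist A B)^2 + (dist B C)^2 \<and>
     (dist A B)^2 < (dist B C)^2 + (dist C A)^2"

end

theory Submission
  imports Defs
begin

text \<open>
  If \<open>P\<close> lies inside the circle with diameter \<open>AR\<close>, then moving from \<open>P\<close> towards \<open>R\<close> increases the
  distance from \<open>A\<close>; and once this distance has increased along a line, by convexity it keeps
  increasing. The points \<open>X\<^sub>1\<^sub>0, X\<^sub>2, X\<^sub>1\<close>, the points \<open>X\<^sub>9, X\<^sub>1, X\<^sub>6\<close> and the points \<open>X\<^sub>9, X\<^sub>1\<^sub>0, X\<^sub>4, X\<^sub>1\<^sub>9\<close> lie on
  three lines in these orders. Hence it suffices that \<open>X\<^sub>1\<^sub>0\<close> is inside the circle with diameter \<open>AX\<^sub>1\<close>,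
  that \<open>X\<^sub>9\<close> and \<open>X\<^sub>6\<close> are inside the circle with diameter \<open>AX\<^sub>4\<close>, and that \<open>X\<^sub>9\<close> lies beyond the
  perpendicular to \<open>AX\<^sub>3\<close> at \<open>X\<^sub>3\<close>. These are polynomial inequalities symmetric in \<open>b\<close> and \<open>c\<close>; in
  \<open>s = b + c\<close> and \<open>d = \<bar>b - c\<bar>\<close> the hypotheses read \<open>2a + d < s\<close> and \<open>ds < a\<^sup>2\<close>. Finally \<open>bc / \<surd>p\<close> with
  \<open>p = (b\<^sup>2 + c\<^sup>2 - a\<^sup>2) / 2\<close> separates \<open>AX\<^sub>1\<^sub>9\<close> from \<open>AX\<^sub>1\<^sub>6\<close>.
\<close>

section \<open>Comparing distances along a line\<close>

lemma dist_less_if_inner_pos: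
  fixes A P Q :: "'a::real_inner"
  assumes "0 < (P - A) \<bullet> (Q - P)"
  shows "dist A P < dist A Q"
proof (rule power_less_imp_less_base)
  have "(dist A Q)\<^sup>2 = (dist A P)\<^sup>2 + 2 * ((P - A) \<bullet> (Q - P)) + (dist P Q)\<^sup>2"
    unfolding dist_norm power2_norm_eq_inner
    by (simp add: inner_simps inner_commute algebra_simps)
  then show "(dist A P)\<^sup>2 < (dist A Q)\<^sup>2"
    using assms zero_le_power2[of "dist P Q"] by linarith
qed simp

lemma dist_less_linepath:
  fixes A P Q R :: "'a::real_inner"
  assumes "0 < (P - A) \<bullet> (R - P)" and "Q \<in> linepath P R ` {0<..<1}"
  shows "dist A P < dist A Q"
proof -
  obtain t where t: "0 < t" and Q: "Q = linepath P R t"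
    using assms(2) by auto
  have "Q - P = t *\<^sub>R (R - P)"
    by (simp add: Q linepath_def algebra_simps)
  then show ?thesis
    using assms(1) t by (intro dist_less_if_inner_pos) simp
qed

lemma dist_less_linepath_end:
  fixes A P Q R :: "'a::real_normed_vector"
  assumes "dist A P < dist A Q" and "Q \<in> linepath P R ` {0<..<1}"
  shows "dist A Q < dist A R"
proof -
  obtain t where t: "0 < t" "t < 1" and Q: "Q = (1 - t) *\<^sub>R P + t *\<^sub>R R"
    using assms(2) by (auto simp: linepath_def)
  have "dist A Q \<le> (1 - t) * dist A P + t * dist A R"
    using convex_onD[OF convex_on_dist[OF convex_UNIV], of t P R A] t by (simp add: Q)
  also have "\<dots> < (1 - t) * dist A Q + t * dist A R"
    using assms(1) t by simp
  finally show ?thesis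
    using t by (simp add: algebra_simps)
qed

section \<open>Polynomial inequalities in the base, the sum and the difference of the legs\<close>

lemma base_sq_minus_leg_diff_pos:
  fixes a s d :: real
  assumes "0 \<le> d" "2 * a + d < s" "d * s < a\<^sup>2"
  shows "0 < a\<^sup>2 - 2 * a * d - d\<^sup>2"
proof -
  have "d * (2 * a + d) \<le> d * s"
    using assms by (intro mult_left_mono) auto
  then show ?thesis
    using assms(3) by (simp add: power2_eq_square algebra_simps)
qed

lemma circumcenter_mittenpunkt_poly:
  fixes a s d :: real
  assumes "0 < a" "0 \<le> d" "2 * a + d < s" "d * s < a\<^sup>2"
  shows "a\<^sup>2 * (s\<^sup>2 - d\<^sup>2) * (2 * a * s - a\<^sup>2 - d\<^sup>2)
    < 2 * (s\<^sup>2 - a\<^sup>2) * (a\<^sup>2 - d\<^sup>2) * (a * s + d\<^sup>2)"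
    (is "?L < ?R")
proof -
  have base: "0 < a\<^sup>2 - 2 * a * d - d\<^sup>2"
    using base_sq_minus_leg_diff_pos assms by blast
  \<comment> \<open>Equality holds for \<open>s = 2 * a + d\<close>, \<open>d * s = a\<^sup>2\<close> (the right isosceles triangle), so each
    summand keeps one of the two vanishing factors.\<close>
  let ?E = "s * a\<^sup>2 * (a\<^sup>2 - 2 * a * d - d\<^sup>2) + 2 * d * (a * s + a * d + d\<^sup>2) * (a\<^sup>2 - d * s)
    + d * a\<^sup>2 * (a\<^sup>2 + 2 * a * d - d\<^sup>2)"
  have "?R - ?L = 2 * d * (a + d)^3 * (a\<^sup>2 - d * s) + (s - 2 * a - d) * ?E"
    by algebra
  moreover have "0 \<le> 2 * d * (a + d)^3 * (a\<^sup>2 - d * s)"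
    using assms by simp
  moreover have "0 < (s - 2 * a - d) * ?E"
  proof (intro mult_pos_pos add_pos_nonneg)
    have "0 \<le> a * d"
      using assms by simp
    then have "0 < a\<^sup>2 + 2 * a * d - d\<^sup>2"
      using base by linarith
    then show "0 \<le> d * a\<^sup>2 * (a\<^sup>2 + 2 * a * d - d\<^sup>2)"
      using assms by simp
  qed (use assms base in auto)
  ultimately show ?thesis
    by linarith
qed

lemma mittenpunkt_orthocenter_poly:
  fixes a s d :: real
  assumes "0 < a" "0 \<le> d" "2 * a + d < s" "d * s < a\<^sup>2"
  shows "(s\<^sup>2 - d\<^sup>2) * (a\<^sup>2 * s\<^sup>2 - a^4 + a\<^sup>2 * d\<^sup>2 - (d\<^sup>2)\<^sup>2)
    < (s\<^sup>2 + d\<^sup>2 - 2 * a\<^sup>2) * (a * s - d\<^sup>2) * (2 * a * s - a\<^sup>2 - d\<^sup>2)"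
    (is "?L < ?R")
proof -
  let ?F = "3 * s\<^sup>2 - 3 * a * s - 5 * a\<^sup>2"
  let ?G = "a\<^sup>2 * s\<^sup>2 * (s - 2 * a) + a^4 * (2 * s + 5 * a - 3 * d) + a * (a\<^sup>2 - d * s) * ?F"
  have "d < a"
  proof (rule power2_less_imp_less)
    have "0 \<le> a * d"
      using assms by simp
    then show "d\<^sup>2 < a\<^sup>2"
      using base_sq_minus_leg_diff_pos[OF assms(2-)] by linarith
  qed (use assms in simp)
  have "0 < 3 * (s - 2 * a) * (s + a) + a\<^sup>2"
    using assms by (intro add_nonneg_pos mult_nonneg_nonneg) auto
  then have F: "0 < ?F"
    by (simp add: power2_eq_square algebra_simps)
  have "0 < ?G"
    using assms F \<open>d < a\<close> by (intro add_pos_nonneg mult_pos_pos mult_nonneg_nonneg) simp_all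
  then have "0 < (s - 2 * a) * ?G"
    using assms by simp
  moreover have "0 \<le> a * d * (s * ?F + 3 * a^3) * (s - 2 * a - d)" "0 \<le> d^4 * s * (2 * s - 3 * a)"
    using assms F by simp_all
  ultimately have "0 < (s - 2 * a) * ?G
      + a * d * (s * ?F + 3 * a^3) * (s - 2 * a - d) + d^4 * s * (2 * s - 3 * a)"
    by linarith
  also have "\<dots> = ?R - ?L"
    by algebra
  finally show ?thesis
    by simp
qed

lemma spieker_incenter_poly:
  fixes a s d :: real
  assumes "0 < a" "0 \<le> d" "2 * a + d < s" "d * s < a\<^sup>2"
  shows "d\<^sup>2 * (s + 7 * a) < (s - a) * (s\<^sup>2 - 4 * a\<^sup>2)"
    (is "?L < ?R")
proof -
  let ?E = "(a\<^sup>2 - d * s) + (s - 2 * a - d) * (s + 3 * a + d) + 2 * a\<^sup>2 + (a - d)\<^sup>2"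
  have "0 < (s - 2 * a) * ?E + d * (s + 7 * a) * (s - 2 * a - d)"
    using assms by (intro add_pos_nonneg mult_pos_pos mult_nonneg_nonneg) auto
  also have "\<dots> = ?R - ?L"
    by algebra
  finally show ?thesis
    by simp
qed

section \<open>Barycentric coordinates\<close>

lemma bary_scale:
  assumes "k \<noteq> 0"
  shows "bary A B C (k * u) (k * v) (k * w) = bary A B C u v w"
proof -
  have "bary A B C (k * u) (k * v) (k * w)
      = (1/(k * (u+v+w))) *\<^sub>R (k *\<^sub>R (u *\<^sub>R A + v *\<^sub>R B + w *\<^sub>R C))"
    by (simp add: bary_def algebra_simps)
  then show ?thesis
    using assms by (simp add: bary_def)
qed

lemma bary_minus_vertex:
  assumes "u + v + w \<noteq> 0"
  shows "bary A B C u v w - A = (1/(u+v+w)) *\<^sub>R (v *\<^sub>R (B - A) + w *\<^sub>R (C - A))"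
proof -
  have "bary A B C u v w - A
      = (1/(u+v+w)) *\<^sub>R ((u *\<^sub>R A + v *\<^sub>R B + w *\<^sub>R C) - (u+v+w) *\<^sub>R A)"
    using assms by (simp add: bary_def scaleR_diff_right)
  then show ?thesis
    by (simp add: algebra_simps)
qed

lemma bary_in_linepath:
  assumes "0 < u\<^sub>1 + v\<^sub>1 + w\<^sub>1" "0 < u\<^sub>2 + v\<^sub>2 + w\<^sub>2" "0 < k" "0 < l" "m \<noteq> 0"
    and "k * u\<^sub>1 + l * u\<^sub>2 = m * u" "k * v\<^sub>1 + l * v\<^sub>2 = m * v" "k * w\<^sub>1 + l * w\<^sub>2 = m * w"
  shows "bary A B C u v w \<in> linepath (bary A B C u\<^sub>1 v\<^sub>1 w\<^sub>1) (bary A B C u\<^sub>2 v\<^sub>2 w\<^sub>2) ` {0<..<1}"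
proof
  define \<sigma>\<^sub>1 \<sigma>\<^sub>2 \<sigma> where "\<sigma>\<^sub>1 = u\<^sub>1 + v\<^sub>1 + w\<^sub>1" and "\<sigma>\<^sub>2 = u\<^sub>2 + v\<^sub>2 + w\<^sub>2"
    and "\<sigma> = k * \<sigma>\<^sub>1 + l * \<sigma>\<^sub>2"
  then have \<sigma>: "\<sigma> = m * u + m * v + m * w"
    unfolding assms(6-8)[symmetric] by algebra
  define t where "t = l * \<sigma>\<^sub>2 / \<sigma>"
  have pos: "0 < k * \<sigma>\<^sub>1" "0 < l * \<sigma>\<^sub>2" "0 < \<sigma>\<^sub>1" "0 < \<sigma>\<^sub>2"
    using assms(1-4) by (simp_all add: \<sigma>\<^sub>1_def \<sigma>\<^sub>2_def)
  then show "t \<in> {0<..<1}"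
    by (simp add: t_def \<sigma>_def)
  have "1 - t = k * \<sigma>\<^sub>1 / \<sigma>"
    using pos by (simp add: t_def \<sigma>_def field_simps)
  then have "(1 - t) / \<sigma>\<^sub>1 = k / \<sigma>" "t / \<sigma>\<^sub>2 = l / \<sigma>"
    using pos by (simp_all add: t_def)
  then have "linepath (bary A B C u\<^sub>1 v\<^sub>1 w\<^sub>1) (bary A B C u\<^sub>2 v\<^sub>2 w\<^sub>2) t
      = (k / \<sigma>) *\<^sub>R (u\<^sub>1 *\<^sub>R A + v\<^sub>1 *\<^sub>R B + w\<^sub>1 *\<^sub>R C)
        + (l / \<sigma>) *\<^sub>R (u\<^sub>2 *\<^sub>R A + v\<^sub>2 *\<^sub>R B + w\<^sub>2 *\<^sub>R C)"
    by (simp add: linepath_def bary_def flip: \<sigma>\<^sub>1_def \<sigma>\<^sub>2_def)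
  also have "\<dots> = (1 / \<sigma>) *\<^sub>R
      ((k * u\<^sub>1 + l * u\<^sub>2) *\<^sub>R A + (k * v\<^sub>1 + l * v\<^sub>2) *\<^sub>R B + (k * w\<^sub>1 + l * w\<^sub>2) *\<^sub>R C)"
    by (simp add: algebra_simps)
  also have "\<dots> = bary A B C (m * u) (m * v) (m * w)"
    by (simp add: bary_def \<sigma> assms(6-8))
  finally show "bary A B C u v w = linepath (bary A B C u\<^sub>1 v\<^sub>1 w\<^sub>1) (bary A B C u\<^sub>2 v\<^sub>2 w\<^sub>2) t"
    using assms(5) by (simp add: bary_scale)
qed

section \<open>Triangles\<close>

locale triangle =
  fixes A B C :: "real^2"
begin

definition a :: real where "a = dist B C"
definition b :: real where "b = dist C A"
definition c :: real where "c = dist A B"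

text \<open>\<open>p\<close>, \<open>q\<close>, \<open>r\<close> are Conway's \<open>S\<^sub>A\<close>, \<open>S\<^sub>B\<close>, \<open>S\<^sub>C\<close>, and \<open>S\<close> is twice the area.\<close>

definition p :: real where "p = (b\<^sup>2 + c\<^sup>2 - a\<^sup>2) / 2"
definition q :: real where "q = (c\<^sup>2 + a\<^sup>2 - b\<^sup>2) / 2"
definition r :: real where "r = (a\<^sup>2 + b\<^sup>2 - c\<^sup>2) / 2"
definition S :: real where "S = sqrt (p * q + q * r + r * p)"

abbreviation X :: "nat \<Rightarrow> real^2" where "X n \<equiv> etc_center n A B C"

lemma sides_nonneg: "0 \<le> a" "0 \<le> b" "0 \<le> c"
  by (simp_all add: a_def b_def c_def)

lemma sides_sq: "a\<^sup>2 = q + r" "b\<^sup>2 = p + r" "c\<^sup>2 = p + q"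
  by (simp_all add: p_def q_def r_def field_simps)

lemma conway_double: "b\<^sup>2 + c\<^sup>2 - a\<^sup>2 = 2 * p" "c\<^sup>2 + a\<^sup>2 - b\<^sup>2 = 2 * q" "a\<^sup>2 + b\<^sup>2 - c\<^sup>2 = 2 * r"
  by (simp_all add: p_def q_def r_def)

lemma inner_sides:
  "(B - A) \<bullet> (B - A) = c\<^sup>2" "(C - A) \<bullet> (C - A) = b\<^sup>2"
  "(B - A) \<bullet> (C - A) = p" "(C - A) \<bullet> (B - A) = p"
  unfolding p_def a_def b_def c_def dist_norm power2_norm_eq_inner
  by (simp_all add: inner_simps inner_commute)

lemma inner_bary:
  assumes "u + v + w \<noteq> 0" "u' + v' + w' \<noteq> 0"
  shows "(bary A B C u v w - A) \<bullet> (bary A B C u' v' w' - A)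
    = (c\<^sup>2 * v * v' + b\<^sup>2 * w * w' + p * (v * w' + w * v')) / ((u+v+w) * (u'+v'+w'))"
proof -
  have "(v *\<^sub>R (B - A) + w *\<^sub>R (C - A)) \<bullet> (v' *\<^sub>R (B - A) + w' *\<^sub>R (C - A))
      = c\<^sup>2 * v * v' + b\<^sup>2 * w * w' + p * (v * w' + w * v')"
    unfolding inner_add_left inner_add_right inner_scaleR_left inner_scaleR_right inner_sides
    by algebra
  then show ?thesis
    by (simp add: bary_minus_vertex assms)
qed

lemma inner_bary_diff_pos:
  assumes "0 < u + v + w" "0 < u' + v' + w'"
    and "(c\<^sup>2 * v\<^sup>2 + b\<^sup>2 * w\<^sup>2 + 2 * p * v * w) * (u' + v' + w')
      < (c\<^sup>2 * v * v' + b\<^sup>2 * w * w' + p * (v * w' + w * v')) * (u + v + w)"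
  shows "0 < (bary A B C u v w - A) \<bullet> (bary A B C u' v' w' - bary A B C u v w)"
proof -
  let ?P = "bary A B C u v w" and ?R = "bary A B C u' v' w'"
  define \<sigma> \<sigma>' where "\<sigma> = u + v + w" and "\<sigma>' = u' + v' + w'"
  have "0 < \<sigma>" "0 < \<sigma>'"
    using assms(1,2) by (simp_all add: \<sigma>_def \<sigma>'_def)
  have "(?P - A) \<bullet> (?P - A) = (c\<^sup>2 * v\<^sup>2 + b\<^sup>2 * w\<^sup>2 + 2 * p * v * w) / (\<sigma> * \<sigma>)"
    using inner_bary[of u v w u v w] \<open>0 < \<sigma>\<close> by (simp add: \<sigma>_def power2_eq_square mult_ac)
  also have "\<dots> < (c\<^sup>2 * v * v' + b\<^sup>2 * w * w' + p * (v * w' + w * v')) / (\<sigma> * \<sigma>')"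
    using assms(3) \<open>0 < \<sigma>\<close> \<open>0 < \<sigma>'\<close>
    by (simp add: divide_less_eq less_divide_eq mult_ac flip: \<sigma>_def \<sigma>'_def)
  also have "\<dots> = (?P - A) \<bullet> (?R - A)"
    using inner_bary[of u v w u' v' w'] \<open>0 < \<sigma>\<close> \<open>0 < \<sigma>'\<close> by (simp add: \<sigma>_def \<sigma>'_def)
  finally show ?thesis
    by (simp add: inner_diff_right)
qed

lemma dist_bary_le:
  assumes "0 < u + v + w" "0 \<le> v" "0 \<le> w"
  shows "dist A (bary A B C u v w) \<le> (v * c + w * b) / (u + v + w)"
proof -
  have "dist A (bary A B C u v w) = norm (v *\<^sub>R (B - A) + w *\<^sub>R (C - A)) / (u + v + w)"
    using assms(1) by (simp add: dist_norm norm_minus_commute[of A] bary_minus_vertex)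
  also have "norm (v *\<^sub>R (B - A) + w *\<^sub>R (C - A)) \<le> v * c + w * b"
    using norm_triangle_ineq[of "v *\<^sub>R (B - A)" "w *\<^sub>R (C - A)"] assms(2,3)
    by (simp add: b_def c_def dist_norm norm_minus_commute)
  finally show ?thesis
    using assms(1) by (simp add: divide_right_mono)
qed

end

section \<open>Centers of an acute triangle\<close>

locale acute = triangle +
  assumes acute_ABC: "acute_triangle A B C"
begin

lemma conway_pos: "0 < p" "0 < q" "0 < r"
  using acute_ABC by (simp_all add: acute_triangle_def p_def q_def r_def a_def b_def c_def)

lemma sides_pos: "0 < a" "0 < b" "0 < c"
proof -
  have "0 < a\<^sup>2" "0 < b\<^sup>2" "0 < c\<^sup>2"
    unfolding sides_sq using conway_pos by simp_all
  then show "0 < a" "0 < b" "0 < c"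
    using sides_nonneg by (simp_all add: order_less_le)
qed

lemma S_sq: "S\<^sup>2 = p * q + q * r + r * p" and S_pos: "0 < S"
  using conway_pos by (simp_all add: S_def add_pos_pos)

lemma heron: "((b + c)\<^sup>2 - a\<^sup>2) * (a\<^sup>2 - (b - c)\<^sup>2) = 4 * S\<^sup>2"
  using sides_sq S_sq by algebra

lemma triangle_strict: "a < b + c" "b < c + a" "c < a + b"
proof -
  have less_add: "x < y + z" if "x\<^sup>2 < y\<^sup>2 + z\<^sup>2" "0 < y" "0 < z" for x y z :: real
  proof (rule power2_less_imp_less)
    have "0 < 2 * y * z"
      using that by simp
    then show "x\<^sup>2 < (y + z)\<^sup>2"
      using that(1) unfolding power2_sum by linarith
  qed (use that in simp)
  show "a < b + c" "b < c + a" "c < a + b"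
    by (rule less_add; use sides_pos conway_pos in \<open>simp add: sides_sq\<close>)+
qed

lemma center_bary:
  "X 1 = bary A B C a b c"
  "X 2 = bary A B C 1 1 1"
  "X 6 = bary A B C (a\<^sup>2) (b\<^sup>2) (c\<^sup>2)"
  "X 9 = bary A B C (a * (b + c - a)) (b * (c + a - b)) (c * (a + b - c))"
  "X 10 = bary A B C (b + c) (c + a) (a + b)"
  by (simp_all add: etc_center_def Let_def etc_coord_def flip: a_def b_def c_def)

lemma circumcenter_bary: "X 3 = bary A B C (a\<^sup>2 * p) (b\<^sup>2 * q) (c\<^sup>2 * r)"
proof -
  have "X 3 = bary A B C (2 * (a\<^sup>2 * p)) (2 * (b\<^sup>2 * q)) (2 * (c\<^sup>2 * r))"
    by (simp add: etc_center_def Let_def etc_coord_def conway_double mult.left_commute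
        flip: a_def b_def c_def)
  then show ?thesis
    by (simp add: bary_scale)
qed

lemma orthocenter_bary: "X 4 = bary A B C (q * r) (r * p) (p * q)"
proof -
  let ?k = "1 / (2 * p * q * r)"
  have "X 4 = bary A B C (?k * (q * r)) (?k * (r * p)) (?k * (p * q))"
    using conway_pos
    by (simp add: etc_center_def Let_def etc_coord_def conway_double flip: a_def b_def c_def)
  then show ?thesis
    using conway_pos by (subst (asm) bary_scale) auto
qed

lemma clawson_bary: "X 19 = bary A B C (a * q * r) (b * r * p) (c * p * q)"
proof -
  let ?k = "1 / (2 * p * q * r)"
  have "X 19 = bary A B C (?k * (a * q * r)) (?k * (b * r * p)) (?k * (c * p * q))"
    using conway_pos
    by (simp add: etc_center_def Let_def etc_coord_def conway_double flip: a_def b_def c_def)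
  then show ?thesis
    using conway_pos by (subst (asm) bary_scale) auto
qed

lemma conway_S_sides: "conway_S a b c = S" "conway_S b c a = S" "conway_S c a b = S"
proof -
  have product: "(a + b + c) * (- a + b + c) * (a - b + c) * (a + b - c) = (2 * S)\<^sup>2"
    "(b + c + a) * (- b + c + a) * (b - c + a) * (b + c - a) = (2 * S)\<^sup>2"
    "(c + a + b) * (- c + a + b) * (c - a + b) * (c + a - b) = (2 * S)\<^sup>2"
    using heron by algebra+
  show "conway_S a b c = S" "conway_S b c a = S" "conway_S c a b = S"
    unfolding conway_S_def product real_sqrt_abs using S_pos by simp_all
qed

lemma isodynamic_bary:
  "X 16 = bary A B C (a\<^sup>2 * (sqrt 3 * p - S)) (b\<^sup>2 * (sqrt 3 * q - S)) (c\<^sup>2 * (sqrt 3 * r - S))"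
  by (simp add: etc_center_def Let_def etc_coord_def conway_S_sides conway_double
      flip: a_def b_def c_def)

lemma mittenpunkt_weight_pos: "0 < a * (b + c - a) + b * (c + a - b) + c * (a + b - c)"
  using sides_pos triangle_strict by (intro add_pos_pos mult_pos_pos) auto

lemma clawson_weight_pos: "0 < a * q * r + b * r * p + c * p * q"
  using conway_pos sides_pos by (intro add_pos_pos mult_pos_pos)

lemma orthocenter_weight_pos: "0 < q * r + r * p + p * q"
  using conway_pos by (intro add_pos_pos mult_pos_pos)

lemma inner_circumcenter_diff_pos:
  assumes "0 < u + v + w" "a\<^sup>2 * b\<^sup>2 * c\<^sup>2 * (u + v + w) < 2 * S\<^sup>2 * (c\<^sup>2 * v + b\<^sup>2 * w)"
  shows "0 < (X 3 - A) \<bullet> (bary A B C u v w - X 3)"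
  unfolding circumcenter_bary
proof (rule inner_bary_diff_pos[OF _ assms(1)])
  have weight: "a\<^sup>2 * p + b\<^sup>2 * q + c\<^sup>2 * r = 2 * S\<^sup>2"
    unfolding S_sq sides_sq by algebra
  then show "0 < a\<^sup>2 * p + b\<^sup>2 * q + c\<^sup>2 * r"
    using S_pos by simp
  have "(c\<^sup>2 * (b\<^sup>2 * q)\<^sup>2 + b\<^sup>2 * (c\<^sup>2 * r)\<^sup>2 + 2 * p * (b\<^sup>2 * q) * (c\<^sup>2 * r)) * (u + v + w)
      = S\<^sup>2 * (a\<^sup>2 * b\<^sup>2 * c\<^sup>2 * (u + v + w))"
    unfolding S_sq sides_sq by algebra
  also have "\<dots> < S\<^sup>2 * (2 * S\<^sup>2 * (c\<^sup>2 * v + b\<^sup>2 * w))"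
    using assms(2) S_pos by (intro mult_strict_left_mono) simp_all
  also have "\<dots> = (c\<^sup>2 * (b\<^sup>2 * q) * v + b\<^sup>2 * (c\<^sup>2 * r) * w
      + p * (b\<^sup>2 * q * w + c\<^sup>2 * r * v)) * (a\<^sup>2 * p + b\<^sup>2 * q + c\<^sup>2 * r)"
    unfolding weight S_sq sides_sq by algebra
  finally show "(c\<^sup>2 * (b\<^sup>2 * q)\<^sup>2 + b\<^sup>2 * (c\<^sup>2 * r)\<^sup>2 + 2 * p * (b\<^sup>2 * q) * (c\<^sup>2 * r))
        * (u + v + w)
      < (c\<^sup>2 * (b\<^sup>2 * q) * v + b\<^sup>2 * (c\<^sup>2 * r) * w
        + p * (b\<^sup>2 * q * w + c\<^sup>2 * r * v)) * (a\<^sup>2 * p + b\<^sup>2 * q + c\<^sup>2 * r)" .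
qed

lemma inner_orthocenter_diff_pos:
  assumes "0 < u + v + w" "c\<^sup>2 * v\<^sup>2 + b\<^sup>2 * w\<^sup>2 + 2 * p * v * w < p * (v + w) * (u + v + w)"
  shows "0 < (bary A B C u v w - A) \<bullet> (X 4 - bary A B C u v w)"
  unfolding orthocenter_bary
proof (rule inner_bary_diff_pos[OF assms(1) orthocenter_weight_pos])
  have "(c\<^sup>2 * v\<^sup>2 + b\<^sup>2 * w\<^sup>2 + 2 * p * v * w) * (q * r + r * p + p * q)
      < p * (v + w) * (u + v + w) * (q * r + r * p + p * q)"
    using assms(2) orthocenter_weight_pos by (rule mult_strict_right_mono)
  also have "\<dots> = (c\<^sup>2 * v * (r * p) + b\<^sup>2 * w * (p * q) + p * (v * (p * q) + w * (r * p)))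
      * (u + v + w)"
    unfolding sides_sq by algebra
  finally show "(c\<^sup>2 * v\<^sup>2 + b\<^sup>2 * w\<^sup>2 + 2 * p * v * w) * (q * r + r * p + p * q)
      < (c\<^sup>2 * v * (r * p) + b\<^sup>2 * w * (p * q) + p * (v * (p * q) + w * (r * p))) * (u + v + w)" .
qed

lemma X2_in_linepath_X10_X1: "X 2 \<in> linepath (X 10) (X 1) ` {0<..<1}"
  unfolding center_bary
  by (rule bary_in_linepath[where k = 1 and l = 1 and m = "a + b + c"]) (use sides_pos in auto)

lemma X1_in_linepath_X9_X6: "X 1 \<in> linepath (X 9) (X 6) ` {0<..<1}"
  unfolding center_bary
proof (rule bary_in_linepath[where k = 1 and l = 2 and m = "a + b + c"])
  show "0 < a\<^sup>2 + b\<^sup>2 + c\<^sup>2"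
    using sides_pos by (simp add: add_pos_pos)
qed (use mittenpunkt_weight_pos sides_pos in \<open>simp_all add: power2_eq_square algebra_simps\<close>)

text \<open>The coefficient of \<open>X\<^sub>1\<^sub>0\<close> in its expression by \<open>X\<^sub>9\<close> and \<open>X\<^sub>4\<close>, which reappears as the
  coefficient of \<open>X\<^sub>1\<^sub>9\<close> in the relation between \<open>X\<^sub>9\<close>, \<open>X\<^sub>4\<close> and \<open>X\<^sub>1\<^sub>9\<close>.\<close>

definition spieker_coeff :: real where
  "spieker_coeff = (b + c - a) * (c + a - b) * (a + b - c) + 4 * a * b * c"

lemma spieker_coeff_pos: "0 < spieker_coeff"
  unfolding spieker_coeff_def using sides_pos triangle_strict
  by (intro add_pos_pos mult_pos_pos) auto

lemma X10_in_linepath_X9_X4: "X 10 \<in> linepath (X 9) (X 4) ` {0<..<1}"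
  unfolding center_bary orthocenter_bary
proof (rule bary_in_linepath[where k = "(a + b + c)\<^sup>2" and l = 4 and m = spieker_coeff])
  show "(a + b + c)\<^sup>2 * (a * (b + c - a)) + 4 * (q * r) = spieker_coeff * (b + c)"
    using conway_double spieker_coeff_def by algebra
  show "(a + b + c)\<^sup>2 * (b * (c + a - b)) + 4 * (r * p) = spieker_coeff * (c + a)"
    using conway_double spieker_coeff_def by algebra
  show "(a + b + c)\<^sup>2 * (c * (a + b - c)) + 4 * (p * q) = spieker_coeff * (a + b)"
    using conway_double spieker_coeff_def by algebra
  show "spieker_coeff \<noteq> 0"
    using spieker_coeff_pos by simp
qed (use mittenpunkt_weight_pos orthocenter_weight_pos sides_pos in simp_all)

lemma X4_in_linepath_X9_X19: "X 4 \<in> linepath (X 9) (X 19) ` {0<..<1}"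
  unfolding center_bary orthocenter_bary clawson_bary
proof (rule bary_in_linepath[where k = "2 * p * q * r" and m = "2 * (a + b + c) * a * b * c"
      and l = spieker_coeff])
  show "2 * p * q * r * (a * (b + c - a)) + spieker_coeff * (a * q * r)
      = 2 * (a + b + c) * a * b * c * (q * r)"
    using conway_double spieker_coeff_def by algebra
  show "2 * p * q * r * (b * (c + a - b)) + spieker_coeff * (b * r * p)
      = 2 * (a + b + c) * a * b * c * (r * p)"
    using conway_double spieker_coeff_def by algebra
  show "2 * p * q * r * (c * (a + b - c)) + spieker_coeff * (c * p * q)
      = 2 * (a + b + c) * a * b * c * (p * q)"
    using conway_double spieker_coeff_def by algebra
qed (use mittenpunkt_weight_pos clawson_weight_pos spieker_coeff_pos conway_pos sides_pos
    in simp_all)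

end

section \<open>Acute triangles with a short base\<close>

locale short_base_acute = acute +
  assumes base_shortest: "dist B C < dist C A" "dist B C < dist A B"
begin

lemma conway_p_greatest: "q < p" "r < p"
proof -
  have "a\<^sup>2 < b\<^sup>2" "a\<^sup>2 < c\<^sup>2"
    unfolding a_def b_def c_def using base_shortest by (auto intro: power_strict_mono)
  then show "q < p" "r < p"
    by (simp_all add: sides_sq)
qed

lemma leg_bounds: "2 * a + \<bar>b - c\<bar> < b + c" "\<bar>b - c\<bar> * (b + c) < a\<^sup>2"
proof -
  show "2 * a + \<bar>b - c\<bar> < b + c"
    using base_shortest by (simp add: a_def b_def c_def)
  have "\<bar>b - c\<bar> * (b + c) = \<bar>(b - c) * (b + c)\<bar>"
    using sides_pos by (simp add: abs_mult)
  also have "(b - c) * (b + c) = r - q"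
    using sides_sq by algebra
  also have "\<bar>r - q\<bar> < a\<^sup>2"
    using conway_pos by (simp add: sides_sq)
  finally show "\<bar>b - c\<bar> * (b + c) < a\<^sup>2" .
qed

lemmas leg_inequalities = sides_pos(1) abs_ge_zero leg_bounds

lemma inner_circumcenter_mittenpunkt_pos: "0 < (X 3 - A) \<bullet> (X 9 - X 3)"
  unfolding center_bary
proof (rule inner_circumcenter_diff_pos[OF mittenpunkt_weight_pos])
  let ?v = "b * (c + a - b)" and ?w = "c * (a + b - c)"
  have "a\<^sup>2 * b\<^sup>2 * c\<^sup>2 * (a * (b + c - a) + ?v + ?w)
      = b * c / 4 * (a\<^sup>2 * ((b + c)\<^sup>2 - (b - c)\<^sup>2) * (2 * a * (b + c) - a\<^sup>2 - (b - c)\<^sup>2))"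
    by algebra
  also have "\<dots> < b * c / 4
      * (2 * ((b + c)\<^sup>2 - a\<^sup>2) * (a\<^sup>2 - (b - c)\<^sup>2) * (a * (b + c) + (b - c)\<^sup>2))"
    using circumcenter_mittenpunkt_poly[OF leg_inequalities] sides_pos
    unfolding power2_abs by (intro mult_strict_left_mono) simp_all
  also have "\<dots> = 2 * S\<^sup>2 * (c\<^sup>2 * ?v + b\<^sup>2 * ?w)"
    using heron by algebra
  finally show "a\<^sup>2 * b\<^sup>2 * c\<^sup>2 * (a * (b + c - a) + ?v + ?w) < 2 * S\<^sup>2 * (c\<^sup>2 * ?v + b\<^sup>2 * ?w)" .
qed

lemma X3_less_X9: "dist A (X 3) < dist A (X 9)"
  using inner_circumcenter_mittenpunkt_pos by (rule dist_less_if_inner_pos)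

lemma inner_mittenpunkt_orthocenter_pos: "0 < (X 9 - A) \<bullet> (X 4 - X 9)"
  unfolding center_bary
proof (rule inner_orthocenter_diff_pos)
  let ?v = "b * (c + a - b)" and ?w = "c * (a + b - c)"
  have "((b + c)\<^sup>2 - (b - c)\<^sup>2) * (a\<^sup>2 * (b + c)\<^sup>2 - a ^ 4 + a\<^sup>2 * (b - c)\<^sup>2 - ((b - c)\<^sup>2)\<^sup>2)
      < ((b + c)\<^sup>2 + (b - c)\<^sup>2 - 2 * a\<^sup>2) * (a * (b + c) - (b - c)\<^sup>2)
        * (2 * a * (b + c) - a\<^sup>2 - (b - c)\<^sup>2)"
    using mittenpunkt_orthocenter_poly[OF leg_inequalities] unfolding power2_abs .
  also have "\<dots> = 4 * (p * (?v + ?w) * (a * (b + c - a) + ?v + ?w))"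
    using conway_double(1) by algebra
  also have "((b + c)\<^sup>2 - (b - c)\<^sup>2) * (a\<^sup>2 * (b + c)\<^sup>2 - a ^ 4 + a\<^sup>2 * (b - c)\<^sup>2 - ((b - c)\<^sup>2)\<^sup>2)
      = 4 * (c\<^sup>2 * ?v\<^sup>2 + b\<^sup>2 * ?w\<^sup>2 + 2 * p * ?v * ?w)"
    using conway_double(1) by algebra
  finally show "c\<^sup>2 * ?v\<^sup>2 + b\<^sup>2 * ?w\<^sup>2 + 2 * p * ?v * ?w
      < p * (?v + ?w) * (a * (b + c - a) + ?v + ?w)"
    by simp
qed (rule mittenpunkt_weight_pos)

lemma X9_less_X10: "dist A (X 9) < dist A (X 10)"
  using inner_mittenpunkt_orthocenter_pos X10_in_linepath_X9_X4 by (rule dist_less_linepath)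

lemma inner_spieker_incenter_pos: "0 < (X 10 - A) \<bullet> (X 1 - X 10)"
  unfolding center_bary
proof (rule inner_bary_diff_pos)
  have "0 < (a + b + c) * (a + b + c)
      * ((b + c - a) * ((b + c)\<^sup>2 - 4 * a\<^sup>2) - (b - c)\<^sup>2 * (b + c + 7 * a)) / 4"
    using spieker_incenter_poly[OF leg_inequalities] sides_pos unfolding power2_abs by simp
  also have "\<dots> = (c\<^sup>2 * (c + a) * b + b\<^sup>2 * (a + b) * c + p * ((c + a) * c + (a + b) * b))
        * (b + c + (c + a) + (a + b))
      - (c\<^sup>2 * (c + a)\<^sup>2 + b\<^sup>2 * (a + b)\<^sup>2 + 2 * p * (c + a) * (a + b)) * (a + b + c)"
    using conway_double(1) by algebra
  finally show "(c\<^sup>2 * (c + a)\<^sup>2 + b\<^sup>2 * (a + b)\<^sup>2 + 2 * p * (c + a) * (a + b)) * (a + b + c)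
      < (c\<^sup>2 * (c + a) * b + b\<^sup>2 * (a + b) * c + p * ((c + a) * c + (a + b) * b))
        * (b + c + (c + a) + (a + b))"
    by simp
qed (use sides_pos in simp_all)

lemma X10_less_X2: "dist A (X 10) < dist A (X 2)"
  using inner_spieker_incenter_pos X2_in_linepath_X10_X1 by (rule dist_less_linepath)

lemma X2_less_X1: "dist A (X 2) < dist A (X 1)"
  using X10_less_X2 X2_in_linepath_X10_X1 by (rule dist_less_linepath_end)

lemma X1_less_X6: "dist A (X 1) < dist A (X 6)"
proof (rule dist_less_linepath_end[OF _ X1_in_linepath_X9_X6])
  show "dist A (X 9) < dist A (X 1)"
    using X9_less_X10 X10_less_X2 X2_less_X1 by simp
qed

lemma X6_less_X4: "dist A (X 6) < dist A (X 4)"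
  unfolding center_bary
proof (intro dist_less_if_inner_pos inner_orthocenter_diff_pos)
  have "q * r < p\<^sup>2"
    using conway_pos conway_p_greatest by (simp add: power2_eq_square mult_strict_mono)
  then have "0 < (q + r) * (p\<^sup>2 - q * r) + p * (q - r)\<^sup>2"
    using conway_pos by (intro add_pos_nonneg) simp_all
  also have "\<dots> = p * (b\<^sup>2 + c\<^sup>2) * (a\<^sup>2 + b\<^sup>2 + c\<^sup>2)
      - (c\<^sup>2 * (b\<^sup>2)\<^sup>2 + b\<^sup>2 * (c\<^sup>2)\<^sup>2 + 2 * p * b\<^sup>2 * c\<^sup>2)"
    unfolding sides_sq by algebra
  finally show "c\<^sup>2 * (b\<^sup>2)\<^sup>2 + b\<^sup>2 * (c\<^sup>2)\<^sup>2 + 2 * p * b\<^sup>2 * c\<^sup>2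
      < p * (b\<^sup>2 + c\<^sup>2) * (a\<^sup>2 + b\<^sup>2 + c\<^sup>2)"
    by simp
qed (use sides_pos in \<open>simp add: add_pos_pos\<close>)

lemma X4_less_X19: "dist A (X 4) < dist A (X 19)"
proof (rule dist_less_linepath_end[OF _ X4_in_linepath_X9_X19])
  show "dist A (X 9) < dist A (X 4)"
    using inner_mittenpunkt_orthocenter_pos by (rule dist_less_if_inner_pos)
qed

lemma dist_X19_less: "dist A (X 19) < b * c / sqrt p"
proof -
  have root: "0 < sqrt p" "sqrt p < b" "sqrt p < c"
    using conway_pos sides_pos by (auto intro!: real_less_lsqrt simp: sides_sq)
  have "dist A (X 19) \<le> (b * r * p * c + c * p * q * b) / (a * q * r + b * r * p + c * p * q)"
    unfolding clawson_bary
    using dist_bary_le[OF clawson_weight_pos] conway_pos sides_pos by simp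
  also have "b * r * p * c + c * p * q * b = p * (q + r) * (b * c)"
    by algebra
  also have "p * (q + r) * (b * c) / (a * q * r + b * r * p + c * p * q)
      < p * (q + r) * (b * c) / (p * (q + r) * sqrt p)"
  proof (intro divide_strict_left_mono mult_pos_pos)
    have "p * (q + r) * sqrt p = r * p * sqrt p + p * q * sqrt p"
      by algebra
    also have "\<dots> < b * r * p + c * p * q"
      using root conway_pos by (intro add_strict_mono) simp_all
    also have "\<dots> < a * q * r + b * r * p + c * p * q"
      using conway_pos sides_pos by simp
    finally show "p * (q + r) * sqrt p < a * q * r + b * r * p + c * p * q" .
  qed (use root conway_pos sides_pos clawson_weight_pos in \<open>simp_all add: add_pos_pos\<close>)
  also have "\<dots> = b * c / sqrt p"
    using conway_pos by simp
  finally show ?thesis .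
qed

lemma weitzenboeck: "sqrt 3 * S < p + q + r"
proof (rule power_less_imp_less_base)
  have "0 < (p - q)\<^sup>2 + (q - r)\<^sup>2 + (r - p)\<^sup>2"
    using conway_p_greatest by (intro add_pos_nonneg) auto
  also have "\<dots> = 2 * ((p + q + r)\<^sup>2 - (sqrt 3 * S)\<^sup>2)"
    unfolding power_mult_distrib S_sq by (simp add: power2_eq_square algebra_simps)
  finally show "(sqrt 3 * S)\<^sup>2 < (p + q + r)\<^sup>2"
    by simp
qed (use conway_pos in simp)

lemma dist_X16_sq: "(dist A (X 16))\<^sup>2 = b\<^sup>2 * c\<^sup>2 / (p + q + r - sqrt 3 * S)"
proof -
  define h \<kappa> where "h = sqrt 3" and "\<kappa> = p + q + r - h * S"
  define u v w where "u = a\<^sup>2 * (h * p - S)" and "v = b\<^sup>2 * (h * q - S)"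
    and "w = c\<^sup>2 * (h * r - S)"
  have h: "h\<^sup>2 = 3" and "0 < \<kappa>"
    using weitzenboeck by (simp_all add: h_def \<kappa>_def)
  have weight: "u + v + w = - 2 * S * \<kappa>"
    using S_sq unfolding u_def v_def w_def sides_sq \<kappa>_def by algebra
  have "(dist A (X 16))\<^sup>2 = (bary A B C u v w - A) \<bullet> (bary A B C u v w - A)"
    by (simp add: isodynamic_bary u_def v_def w_def h_def dist_norm norm_minus_commute[of A]
        flip: power2_norm_eq_inner)
  also have "\<dots> = (c\<^sup>2 * v * v + b\<^sup>2 * w * w + p * (v * w + w * v))
      / ((- 2 * S * \<kappa>) * (- 2 * S * \<kappa>))"
    using inner_bary[of u v w u v w] S_pos \<open>0 < \<kappa>\<close> by (simp add: weight)
  also have "c\<^sup>2 * v * v + b\<^sup>2 * w * w + p * (v * w + w * v)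
      = b\<^sup>2 * c\<^sup>2 * (b\<^sup>2 * (h * q - S)\<^sup>2 + c\<^sup>2 * (h * r - S)\<^sup>2
        + 2 * p * (h * q - S) * (h * r - S))"
    unfolding v_def w_def by algebra
  also have "b\<^sup>2 * (h * q - S)\<^sup>2 + c\<^sup>2 * (h * r - S)\<^sup>2 + 2 * p * (h * q - S) * (h * r - S)
      = h\<^sup>2 * ((q + r) * (p * q + q * r + r * p)) - 4 * h * S * (p * q + q * r + r * p)
        + S\<^sup>2 * (4 * p + q + r)"
    unfolding sides_sq by algebra
  also have "\<dots> = 4 * S\<^sup>2 * \<kappa>"
    unfolding h S_sq[symmetric] \<kappa>_def by algebra
  finally show ?thesis
    using S_pos \<open>0 < \<kappa>\<close> by (simp add: h_def \<kappa>_def power2_eq_square)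
qed

lemma dist_X16_greater: "b * c / sqrt p < dist A (X 16)"
proof (rule power_less_imp_less_base)
  have "q + r < sqrt 3 * S"
  proof (rule power_less_imp_less_base)
    have "q * q < p * q" "r * r < p * r" "0 < q * r" "0 < p * q" "0 < r * p"
      using conway_pos conway_p_greatest by simp_all
    then show "(q + r)\<^sup>2 < (sqrt 3 * S)\<^sup>2"
      unfolding power_mult_distrib S_sq by (simp add: power2_eq_square algebra_simps)
  qed (use S_pos in simp)
  then have "b\<^sup>2 * c\<^sup>2 / p < b\<^sup>2 * c\<^sup>2 / (p + q + r - sqrt 3 * S)"
    using weitzenboeck sides_pos conway_pos by (intro divide_strict_left_mono) simp_all
  then show "(b * c / sqrt p)\<^sup>2 < (dist A (X 16))\<^sup>2"
    using conway_pos by (simp add: dist_X16_sq power_divide power_mult_distrib)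
qed simp

lemma X19_less_X16: "dist A (X 19) < dist A (X 16)"
  using dist_X19_less dist_X16_greater by (rule less_trans)

end

theorem theorem4p1:
  fixes A B C :: "real^2"
  assumes "acute_triangle A B C"
    and "dist B C < dist C A" and "dist B C < dist A B"
  shows "dist A (etc_center 3 A B C) < dist A (etc_center 9 A B C) \<and>
         dist A (etc_center 9 A B C) < dist A (etc_center 10 A B C) \<and>
         dist A (etc_center 10 A B C) < dist A (etc_center 2 A B C) \<and>
         dist A (etc_center 2 A B C) < dist A (etc_center 1 A B C) \<and>
         dist A (etc_center 1 A B C) < dist A (etc_center 6 A B C) \<and>
         dist A (etc_center 6 A B C) < dist A (etc_center 4 A B C) \<and>
         dist A (etc_center 4 A B C) < dist A (etc_center 19 A B C) \<and>
         dist A (etc_center 19 A B C) < dist A (etc_center 16 A B C)"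
proof -
  interpret short_base_acute A B C
    by unfold_locales (use assms in simp_all)
  show ?thesis
    using X3_less_X9 X9_less_X10 X10_less_X2 X2_less_X1 X1_less_X6 X6_less_X4 X4_less_X19
      X19_less_X16 by blast
qed

end
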